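(* Let $(X, T, \mu)$ be an ergodic aperiodic dynamical system. Let $F : \mathbb{R} \to \mathbb{R}$ be increasing. Then there exists a sequence $(U_n)_{n \geq 0}$ of measurable subsets of $X$ with $\mu(U_n) > 0$ for all $n$, $\mu(U_n) \to 0$ and $F_{U_n} \Rightarrow F$ if and only if $F \in \mathcal{F}$. Hence the possible asymptotics for hitting times in $(X,T,\mu)$ (that is, the weak limits of sequences $(F_{U_n})$ with $\mu(U_n)>0$, $\mu(U_n)\to 0$) are exactly the elements of $\mathcal{F}$.
   Context: Dynamical system: $(X,\mathcal{B},\mu)$ is a probability space and $T : X \to X$ is measurable and preserves $\mu$. It is ergodic in the usual sense. It is aperiodic if $\mu(\{x : T^m x = x\}) = 0$ for every integer $m \geq 1$. "Increasing" means non-decreasing (not necessarily strictly increasing). For $U \in \mathcal{B}$ with $\mu(U) > 0$, the hitting time is $\tau_U(x) = \inf\{k \geq 1 : T^k x \in U\}$ (finite $\mu$-a.s. by ergodicity), and $F_U(t) = \mu(\{x \in X : \mu(U)\tau_U(x) \leq t\})$ for $t \in \mathbb{R}$. Weak convergence: a sequence of distribution functions $(F_n)$ converges weakly to a function $F$, written $F_n \Rightarrow F$, if $F$ is increasing and $F_n(t_0) \to F(t_0)$ at every point $t_0$ of continuity of $F$ ($F$ need not itself be a distribution function of a probability measure). $\mathcal{F}$ is the set of all functions $F : \mathbb{R} \to [0,1]$ such that $F$ is increasing, $F$ is null on $]-\infty, 0]$, $F$ is continuous, $F$ is concave on $[0,+\infty[$, and $F(t) \leq t$ for all $t \geq 0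$.
   Formalization: The probability space is also assumed to have a countable family of measurable sets separating points off a null set (true for standard spaces); without this the claim fails, e.g. for an irrational rotation with the trivial sigma-algebra. *)

theory Defs
  imports "HOL-Probability.Probability"
begin

definition ergodic_system :: "'a measure \<Rightarrow> ('a \<Rightarrow> 'a) \<Rightarrow> bool" where
  "ergodic_system M T \<longleftrightarrow>
     prob_space M \<and>
     T \<in> measurable M M \<and>
     distr M M T = M \<and>
     (\<forall>A\<in>sets M. T -` A \<inter> space M = A \<longrightarrow> measure M A = 0 \<or> measure M A = 1)"

text \<open>
  Aperiodicity is stated with the almost-everywhere quantifier and not through
  \<open>measure M\<close>, because the latter is 0 on every non-measurable set. If the set of
  points fixed by the m-th iterate is measurable, this says that it has measure 0.
\<close>

definition aperiodic :: "'a measure \<Rightarrow> ('a \<Rightarrow> 'a) \<Rightarrow> bool" where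
  "aperiodic M T \<longleftrightarrow> (\<forall>m\<ge>1. AE x in M. (T ^^ m) x \<noteq> x)"

text \<open>
  The standing convention on probability spaces in ergodic theory: some countable
  family of measurable sets separates the points of the space, up to a null set.
  Standard Borel spaces, their completions, and Lebesgue (Rokhlin) spaces satisfy it.
  Aperiodicity is a condition on points, and it says something about the measurable
  sets only if these sets separate points. With the trivial sigma-algebra, whose only
  members are the empty set and the whole space, every map without periodic points is
  ergodic and aperiodic, but there are no sets of small positive measure.
\<close>

definition countably_separated :: "'a measure \<Rightarrow> bool" where
  "countably_separated M \<longleftrightarrow>
     (\<exists>C N. countable C \<and> C \<subseteq> sets M \<and> N \<in> null_sets M \<and>
        (\<forall>x\<in>space M - N. \<forall>y\<in>space M - N. x \<noteq> y \<longrightarrow> (\<exists>A\<in>C. (x \<in> A) \<noteq> (y \<in> A))))"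

text \<open>The infimum of the empty set is \<open>\<infinity>\<close>, so a point that never enters \<open>U\<close> has
  hitting time \<open>\<infinity>\<close>.\<close>

definition hitting_time :: "('a \<Rightarrow> 'a) \<Rightarrow> 'a set \<Rightarrow> 'a \<Rightarrow> enat" where
  "hitting_time T U x = Inf (enat ` {k. 1 \<le> k \<and> (T ^^ k) x \<in> U})"

definition hitting_cdf :: "'a measure \<Rightarrow> ('a \<Rightarrow> 'a) \<Rightarrow> 'a set \<Rightarrow> real \<Rightarrow> real" where
  "hitting_cdf M T U t =
     measure M {x \<in> space M. ereal (measure M U) * ereal_of_enat (hitting_time T U x) \<le> ereal t}"

text \<open>The limit \<open>F\<close> need not be the distribution function of a probability measure;
  \<open>weak_conv\<close> is convergence at the points of continuity of \<open>F\<close>.\<close>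

definition weakly_converges :: "(nat \<Rightarrow> real \<Rightarrow> real) \<Rightarrow> (real \<Rightarrow> real) \<Rightarrow> bool" where
  "weakly_converges Fs F \<longleftrightarrow> mono F \<and> weak_conv Fs F"

definition hitting_asymptotic :: "'a measure \<Rightarrow> ('a \<Rightarrow> 'a) \<Rightarrow> (real \<Rightarrow> real) \<Rightarrow> bool" where
  "hitting_asymptotic M T F \<longleftrightarrow>
     (\<exists>U :: nat \<Rightarrow> 'a set.
        (\<forall>n. U n \<in> sets M) \<and>
        (\<forall>n. measure M (U n) > 0) \<and>
        (\<lambda>n. measure M (U n)) \<longlonglongrightarrow> 0 \<and>
        weakly_converges (\<lambda>n. hitting_cdf M T (U n)) F)"

definition asymptotics_class :: "(real \<Rightarrow> real) set" where
  "asymptotics_class =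
     {F. (\<forall>t. 0 \<le> F t \<and> F t \<le> 1) \<and> mono F \<and> (\<forall>t\<le>0. F t = 0) \<and>
         continuous_on UNIV F \<and> concave_on {0..} F \<and> (\<forall>t\<ge>0. F t \<le> t)}"

end

theory Submission
  imports Defs "HOL-Real_Asymp.Real_Asymp"
begin

text \<open>
  Everything rests on one identity. Let \<open>\<rho> r\<close> be the measure of the set of points of \<open>U\<close> whose
  return time to \<open>U\<close> exceeds \<open>r\<close>. Invariance of the measure gives
  \<open>\<mu>(\<tau>\<^sub>U = r + 1) = \<rho> r\<close>, so that \<open>F\<^sub>U(t)\<close> is the sum of \<open>\<rho> r\<close> over \<open>r < \<lfloor>t / \<mu>(U)\<rfloor>\<close>
  (\<open>hitting_cdf_eq_sum\<close>). The summands decrease in \<open>r\<close> and are at most \<open>\<mu>(U)\<close>.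

  Necessity. Partial sums of a decreasing sequence are concave, so \<open>F\<^sub>U\<close> has at every point a
  supporting line of slope in \<open>[0, 1]\<close>, up to an error \<open>\<mu>(U)\<close> (\<open>hitting_cdf_supporting_line\<close>).
  When \<open>\<mu>(U\<^sub>n)\<close> tends to 0, the limit is 1-Lipschitz at its continuity points, hence everywhere;
  so it is continuous, the convergence holds at every point, and the supporting line inequality
  passes to the limit and gives concavity.

  Sufficiency. Let \<open>F\<close> be in the class. It is enough to produce sets \<open>U\<close> whose tails \<open>\<rho> r\<close> are
  proportional to the increments of \<open>F\<close> on a grid of mesh \<open>1 / L\<close>. Concavity makes these increments
  decreasing, and \<open>F t \<le> t\<close> bounds them by \<open>1 / L\<close>; so, after multiplication by \<open>K L\<close> and rounding,
  they are the numbers \<open>c r\<close> of gaps longer than \<open>r\<close> in some list of \<open>K\<close> gaps (\<open>tail_counts\<close>,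
  \<open>conjugate_sequence\<close>). Because \<open>F \<le> 1\<close>, the gaps have total length at most \<open>K (L + 1)\<close>, and they
  fit into a Rokhlin tower with one level more. The union \<open>U\<close> of the levels of the tower at the
  endpoints of the gaps then has the required return times, since a point of a level
  \<open>T\<^sup>-\<^sup>i B\<close> descends the tower deterministically (\<open>return_tail_tower_pattern\<close>). If \<open>F\<close> stays
  below 1, the levels left over at the top of the tower carry the mass that escapes to infinity;
  if \<open>F\<close> has slope less than 1 at 0, the many gaps of length 1 carry the atom of the return law at 0.

  The tower works for non-invertible \<open>T\<close> because its levels are preimages of the base. It is built
  from a set \<open>A\<close> of small positive measure: the base consists of the points whose first visit to \<open>A\<close>
  occurs at a positive multiple of the height, and by ergodicity almost every point visits \<open>A\<close>
  (\<open>Rokhlin_tower\<close>). Such sets \<open>A\<close> exist because otherwise a countable separating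
  family would isolate a point of positive mass, which Poincare recurrence makes periodic
  (\<open>small_sets\<close>).
\<close>

section \<open>Hitting times and return times\<close>

lemma hitting_time_le_iff: "hitting_time T U x \<le> enat s \<longleftrightarrow> (\<exists>j\<in>{1..s}. (T ^^ j) x \<in> U)"
proof
  assume *: "hitting_time T U x \<le> enat s"
  let ?S = "enat ` {k. 1 \<le> k \<and> (T ^^ k) x \<in> U}"
  have "?S \<noteq> {}"
  proof
    assume "?S = {}"
    with * show False unfolding hitting_time_def by (metis Inf_enat_def enat_ile enat.distinct(1))
  qed
  then have "hitting_time T U x \<in> ?S"
    unfolding hitting_time_def Inf_enat_def by (auto intro: LeastI)
  then show "\<exists>j\<in>{1..s}. (T ^^ j) x \<in> U" using * by auto
next
  assume "\<exists>j\<in>{1..s}. (T ^^ j) x \<in> U"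
  then obtain j where j: "1 \<le> j" "j \<le> s" "(T ^^ j) x \<in> U" by auto
  then have "hitting_time T U x \<le> enat j"
    unfolding hitting_time_def by (intro Inf_lower) auto
  then show "hitting_time T U x \<le> enat s" using j order_trans by fastforce
qed

lemma scaled_time_le_iff:
  fixes m :: real and h :: enat
  assumes "m > 0"
  shows "ereal m * ereal_of_enat h \<le> ereal t \<longleftrightarrow> 0 \<le> t \<and> h \<le> enat (nat \<lfloor>t / m\<rfloor>)"
proof (cases h)
  case (enat n)
  have "m * real n \<le> t \<longleftrightarrow> real n \<le> t / m"
    using assms by (simp add: field_simps)
  also have "\<dots> \<longleftrightarrow> 0 \<le> t \<and> n \<le> nat \<lfloor>t / m\<rfloor>"
  proof (cases "0 \<le> t")
    case True
    then show ?thesis using assms by (simp add: le_nat_floor le_nat_iff le_floor_iff)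
  next
    case False
    then have "t / m < 0" using assms by (simp add: divide_neg_pos)
    then show ?thesis using False by (simp add: not_le)
  qed
  finally show ?thesis using enat by simp
qed (use assms in auto)

text \<open>Discrete concavity: the next increment \<open>a m\<close> is the slope of a line that passes through the
  partial sum at \<open>m\<close> and lies above all partial sums, on both sides of \<open>m\<close>.\<close>

lemma antimono_sum_supporting_line:
  fixes a :: "nat \<Rightarrow> real"
  assumes "\<And>i j. i \<le> j \<Longrightarrow> a j \<le> a i"
  shows "(\<Sum>r<k. a r) \<le> (\<Sum>r<m. a r) + (real k - real m) * a m"
proof (cases "m \<le> k")
  case True
  have "(\<Sum>r<k. a r) = (\<Sum>r<m. a r) + (\<Sum>r=m..<k. a r)"
    using True by (simp add: lessThan_atLeast0 sum.atLeastLessThan_concat)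
  also have "(\<Sum>r=m..<k. a r) \<le> (\<Sum>r=m..<k. a m)"
    by (intro sum_mono assms) auto
  finally show ?thesis using True by (simp add: of_nat_diff)
next
  case False
  have "(\<Sum>r<m. a r) = (\<Sum>r<k. a r) + (\<Sum>r=k..<m. a r)"
    using False by (simp add: lessThan_atLeast0 sum.atLeastLessThan_concat)
  moreover have "(\<Sum>r=k..<m. a m) \<le> (\<Sum>r=k..<m. a r)"
    by (intro sum_mono assms) auto
  ultimately show ?thesis using False by (simp add: of_nat_diff algebra_simps)
qed

locale measure_preserving_map = prob_space M for M :: "'a measure" +
  fixes T :: "'a \<Rightarrow> 'a"
  assumes map_measurable: "T \<in> measurable M M"
    and distr_map: "distr M M T = M"
begin

lemma iterate_measurable [measurable]: "T ^^ k \<in> measurable M M"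
proof (induction k)
  case (Suc k)
  then show ?case
    using measurable_comp[OF Suc map_measurable] by (simp add: comp_def)
qed (simp add: id_def)

lemma iterate_in_space: "x \<in> space M \<Longrightarrow> (T ^^ k) x \<in> space M"
  using measurable_space[OF iterate_measurable] by blast

lemma iterate_add: "(T ^^ (i + j)) x = (T ^^ j) ((T ^^ i) x)"
  by (metis add.commute comp_apply funpow_add)

definition preim :: "nat \<Rightarrow> 'a set \<Rightarrow> 'a set" where
  "preim k A = {x \<in> space M. (T ^^ k) x \<in> A}"

lemma preim_sets [measurable, simp]: "A \<in> sets M \<Longrightarrow> preim k A \<in> sets M"
  using measurable_sets[OF iterate_measurable, of A k]
  by (simp add: preim_def vimage_def Int_def conj_commute)

lemma measure_preim: "A \<in> sets M \<Longrightarrow> prob (preim k A) = prob A"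
proof (induction k)
  case 0
  then show ?case using sets.sets_into_space by (auto simp: preim_def intro!: arg_cong[where f=prob])
next
  case (Suc k)
  have "preim (Suc k) A = T -` preim k A \<inter> space M"
    using measurable_space[OF map_measurable] by (auto simp: preim_def funpow_swap1)
  then have "prob (preim (Suc k) A) = measure (distr M M T) (preim k A)"
    using Suc.prems by (simp add: measure_distr[OF map_measurable])
  then show ?case using Suc distr_map by simp
qed

text \<open>The event \<open>\<tau>\<^sub>U > r\<close>, written without the infimum so that its measurability is clear.\<close>

definition late :: "'a set \<Rightarrow> nat \<Rightarrow> 'a set" where
  "late U r = {x \<in> space M. \<forall>j\<in>{1..r}. (T ^^ j) x \<notin> U}"

lemma late_sets [measurable, simp]: "U \<in> sets M \<Longrightarrow> late U r \<in> sets M"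
proof -
  assume "U \<in> sets M"
  then have "space M - (\<Union>j\<in>{1..r}. preim j U) \<in> sets M"
    by auto
  then show ?thesis
    by (rule back_subst[of "\<lambda>A. A \<in> sets M"]) (auto simp: late_def preim_def)
qed

lemma late_0 [simp]: "late U 0 = space M"
  by (simp add: late_def)

lemma late_antimono: "r \<le> s \<Longrightarrow> late U s \<subseteq> late U r"
  by (auto simp: late_def)

text \<open>The recursion behind the basic identity: together with invariance, it says that the event
  \<open>\<tau>\<^sub>U > r\<close> loses exactly the mass of its intersection with \<open>U\<close> when \<open>r\<close> increases by one.\<close>

lemma late_Suc: "late U (Suc r) = preim 1 (late U r - U)"
proof -
  have "(\<forall>j\<in>{1..Suc r}. (T ^^ j) x \<notin> U) \<longleftrightarrow>
        (\<forall>j\<in>{1..r}. (T ^^ j) (T x) \<notin> U) \<and> T x \<notin> U" for x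
  proof -
    have shift: "{1..Suc r} = insert 1 (Suc ` {1..r})"
      by auto
    show ?thesis
      unfolding shift by (auto simp: funpow_swap1 simp del: image_Suc_atLeastAtMost)
  qed
  then show ?thesis
    using measurable_space[OF map_measurable] by (auto simp: late_def preim_def)
qed

text \<open>Up to the factor \<open>\<mu>(U)\<close>, the tail at \<open>r\<close> of the return time to \<open>U\<close> under the measure
  conditioned on \<open>U\<close>.\<close>

definition return_tail :: "'a set \<Rightarrow> nat \<Rightarrow> real" where
  "return_tail U r = prob (U \<inter> late U r)"

lemma prob_late:
  assumes "U \<in> sets M"
  shows "prob (late U s) = 1 - (\<Sum>r<s. return_tail U r)"
proof (induction s)
  case 0
  then show ?case by (simp add: prob_space)
next
  case (Suc s)
  have "prob (late U (Suc s)) = prob (late U s - U)"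
    unfolding late_Suc using assms by (intro measure_preim) auto
  also have "\<dots> = prob (late U s) - return_tail U s"
    using assms by (simp add: finite_measure_Diff' return_tail_def Int_commute)
  finally show ?case using Suc by simp
qed

lemma return_tail_nonneg: "0 \<le> return_tail U r"
  by (simp add: return_tail_def)

lemma return_tail_antimono: "U \<in> sets M \<Longrightarrow> r \<le> s \<Longrightarrow> return_tail U s \<le> return_tail U r"
  unfolding return_tail_def using late_antimono[of r s U] by (intro finite_measure_mono) auto

lemma return_tail_le: "U \<in> sets M \<Longrightarrow> return_tail U r \<le> prob U"
  unfolding return_tail_def by (intro finite_measure_mono) auto

lemma hitting_cdf_nonpos:
  assumes "prob U > 0" "t \<le> 0"
  shows "hitting_cdf M T U t = 0"
proof -
  have "{x \<in> space M. ereal (prob U) * ereal_of_enat (hitting_time T U x) \<le> ereal t} = {}"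
    using assms by (simp add: scaled_time_le_iff hitting_time_le_iff)
  then show ?thesis unfolding hitting_cdf_def by (simp only: measure_empty)
qed

lemma hitting_cdf_eq_sum:
  assumes "U \<in> sets M" "prob U > 0" "t \<ge> 0"
  shows "hitting_cdf M T U t = (\<Sum>r<nat \<lfloor>t / prob U\<rfloor>. return_tail U r)"
proof -
  have "{x \<in> space M. ereal (prob U) * ereal_of_enat (hitting_time T U x) \<le> ereal t}
      = space M - late U (nat \<lfloor>t / prob U\<rfloor>)"
    using assms by (auto simp: scaled_time_le_iff hitting_time_le_iff late_def)
  then have "hitting_cdf M T U t = 1 - prob (late U (nat \<lfloor>t / prob U\<rfloor>))"
    using assms by (simp add: hitting_cdf_def prob_compl)
  then show ?thesis using prob_late[OF assms(1)] by simp
qed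

lemma hitting_cdf_range: "0 \<le> hitting_cdf M T U t" "hitting_cdf M T U t \<le> 1"
  by (simp_all add: hitting_cdf_def)

text \<open>The error \<open>prob U\<close> is the price of the rounding in \<open>\<lfloor>t / prob U\<rfloor>\<close>. The slope is that of the
  next increment, so it lies between 0 and 1; this one inequality yields both the Lipschitz bound and
  the concavity of the limits.\<close>

lemma hitting_cdf_supporting_line:
  assumes "U \<in> sets M" "prob U > 0" "t \<ge> 0"
  obtains p where "0 \<le> p" "p \<le> 1"
    "\<And>s. 0 \<le> s \<Longrightarrow> hitting_cdf M T U s \<le> hitting_cdf M T U t + p * (s - t) + prob U"
proof
  define m where "m = nat \<lfloor>t / prob U\<rfloor>"
  let ?p = "return_tail U m / prob U"
  show "0 \<le> ?p" "?p \<le> 1"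
    using assms return_tail_nonneg return_tail_le by auto
  fix s :: real assume "0 \<le> s"
  define k where "k = nat \<lfloor>s / prob U\<rfloor>"
  have "0 \<le> t / prob U" "0 \<le> s / prob U" using assms \<open>0 \<le> s\<close> by auto
  then have "real k \<le> s / prob U" "t / prob U \<le> real m + 1"
    unfolding k_def m_def by linarith+
  then have "real k - real m \<le> (s - t) / prob U + 1"
    by (simp add: diff_divide_distrib)
  then have "(real k - real m) * return_tail U m \<le> ((s - t) / prob U + 1) * return_tail U m"
    by (intro mult_right_mono return_tail_nonneg)
  also have "\<dots> \<le> ?p * (s - t) + prob U"
    using return_tail_le[OF assms(1), of m] by (simp add: algebra_simps)
  finally show "hitting_cdf M T U s \<le> hitting_cdf M T U t + ?p * (s - t) + prob U"
    using antimono_sum_supporting_line[of "return_tail U" k m] return_tail_antimono assms \<open>0 \<le> s\<close>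
    by (simp add: hitting_cdf_eq_sum k_def m_def)
qed

lemma hitting_cdf_Lipschitz:
  assumes "U \<in> sets M" "prob U > 0" "t \<le> s"
  shows "hitting_cdf M T U s \<le> hitting_cdf M T U t + (s - t) + prob U"
proof (cases "s \<le> 0")
  case True
  then show ?thesis using assms by (simp add: hitting_cdf_nonpos)
next
  case False
  define t' where "t' = max t 0"
  have t': "t' \<ge> 0" "t' \<ge> t" "t' \<le> s"
    using False assms by (auto simp: t'_def)
  obtain p where p: "0 \<le> p" "p \<le> 1"
    "\<And>s. 0 \<le> s \<Longrightarrow> hitting_cdf M T U s \<le> hitting_cdf M T U t' + p * (s - t') + prob U"
    using hitting_cdf_supporting_line[OF assms(1,2) t'(1)] by blast
  have "p * (s - t') \<le> 1 * (s - t)"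
    using p t' by (intro mult_mono) auto
  moreover have "hitting_cdf M T U t' = hitting_cdf M T U t"
    using assms by (auto simp: t'_def max_def hitting_cdf_nonpos)
  ultimately show ?thesis using p(3)[of s] False by simp
qed

end

section \<open>Limits of hitting time distributions\<close>

text \<open>A monotone function has only countably many discontinuities, so any two points can be enclosed
  between continuity points that are arbitrarily close to them.\<close>

lemma mono_lipschitz_from_continuity_points:
  fixes F :: "real \<Rightarrow> real"
  assumes "mono F"
    and "\<And>x y. isCont F x \<Longrightarrow> isCont F y \<Longrightarrow> x \<le> y \<Longrightarrow> F y - F x \<le> y - x"
    and "x \<le> y"
  shows "F y - F x \<le> y - x"
proof (rule field_le_epsilon)
  fix e :: real assume "e > 0"
  note dense = open_minus_countable[OF mono_ctble_discont[OF \<open>mono F\<close>]]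
  obtain a where a: "x - e / 2 < a" "a < x" "isCont F a"
    using dense[of "{x - e / 2<..<x}"] \<open>e > 0\<close> by fastforce
  obtain b where b: "y < b" "b < y + e / 2" "isCont F b"
    using dense[of "{y<..<y + e / 2}"] \<open>e > 0\<close> by fastforce
  have "F y - F x \<le> F b - F a"
    using a b by (intro diff_mono monoD[OF \<open>mono F\<close>]) auto
  also have "\<dots> \<le> b - a"
    using a b assms(2,3) by simp
  finally show "F y - F x \<le> y - x + e"
    using a b by simp
qed

context measure_preserving_map
begin

text \<open>Both estimates on \<open>F\<^sub>U\<close> carry an error \<open>\<mu>(U)\<close> that vanishes in the limit. The Lipschitz bound comes
  first: it gives continuity, and with it convergence at every point, which the concavity argument
  needs.\<close>

lemma hitting_asymptotic_imp_class:
  assumes "hitting_asymptotic M T F"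
  shows "mono F" "F \<in> asymptotics_class"
proof -
  obtain U where U: "\<And>n. U n \<in> sets M" "\<And>n. prob (U n) > 0"
      "(\<lambda>n. prob (U n)) \<longlonglongrightarrow> 0" and "mono F"
    and conv: "\<And>x. isCont F x \<Longrightarrow> (\<lambda>n. hitting_cdf M T (U n) x) \<longlonglongrightarrow> F x"
    using assms unfolding hitting_asymptotic_def weakly_converges_def weak_conv_def by blast
  show "mono F" by fact
  have lip: "F y - F x \<le> y - x" if "x \<le> y" for x y
  proof (rule mono_lipschitz_from_continuity_points[OF \<open>mono F\<close> _ that])
    fix x y assume xy: "isCont F x" "isCont F y" "x \<le> y"
    have "(\<lambda>n. hitting_cdf M T (U n) x + (y - x) + prob (U n)) \<longlonglongrightarrow> F x + (y - x) + 0"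
      by (intro tendsto_intros conv xy U)
    then have "F y \<le> F x + (y - x) + 0"
      using hitting_cdf_Lipschitz[OF U(1,2) xy(3)] by (intro LIMSEQ_le[OF conv[OF xy(2)]]) auto
    then show "F y - F x \<le> y - x" by simp
  qed
  have "\<bar>F y - F x\<bar> \<le> \<bar>y - x\<bar>" for x y
    using lip[of x y] lip[of y x] monoD[OF \<open>mono F\<close>, of x y] monoD[OF \<open>mono F\<close>, of y x]
    by (cases "x \<le> y") auto
  then have "1-lipschitz_on UNIV F"
    by (intro lipschitz_onI) (auto simp: dist_real_def)
  then have cont: "continuous_on UNIV F"
    by (rule lipschitz_on_continuous_on)
  \<comment> \<open>Continuity everywhere upgrades the convergence to every point.\<close>
  then have lim: "(\<lambda>n. hitting_cdf M T (U n) x) \<longlonglongrightarrow> F x" for x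
    by (intro conv) (simp add: continuous_on_eq_continuous_at)
  have range: "0 \<le> F t" "F t \<le> 1" for t
    using LIMSEQ_le_const[OF lim] LIMSEQ_le_const2[OF lim] hitting_cdf_range by blast+
  have null: "F t = 0" if "t \<le> 0" for t
    using lim[of t] that U(2) by (simp add: hitting_cdf_nonpos LIMSEQ_const_iff)
  have conc: "concave_on {0..} F"
    unfolding concave_on_iff
  proof (intro conjI ballI allI impI)
    fix x y u v :: real
    assume xy: "x \<in> {0..}" "y \<in> {0..}" and uv: "0 \<le> u" "0 \<le> v" "u + v = 1"
    define t where "t = u * x + v * y"
    have "t \<ge> 0" using xy uv by (simp add: t_def)
    let ?F = "\<lambda>n. hitting_cdf M T (U n)"
    have "u * ?F n x + v * ?F n y \<le> ?F n t + prob (U n)" for n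
    proof -
      obtain p where p: "\<And>s. 0 \<le> s \<Longrightarrow> ?F n s \<le> ?F n t + p * (s - t) + prob (U n)"
        using hitting_cdf_supporting_line[OF U(1,2) \<open>t \<ge> 0\<close>] by metis
      have "u * ?F n x + v * ?F n y
          \<le> u * (?F n t + p * (x - t) + prob (U n)) + v * (?F n t + p * (y - t) + prob (U n))"
        using xy uv by (intro add_mono mult_left_mono p) auto
      also have "\<dots> = (u + v) * (?F n t + prob (U n)) + p * (t - (u + v) * t)"
        by (simp add: algebra_simps t_def)
      finally show ?thesis using uv by simp
    qed
    moreover have "(\<lambda>n. ?F n t + prob (U n)) \<longlonglongrightarrow> F t + 0"
      by (intro tendsto_intros lim U)
    moreover have "(\<lambda>n. u * ?F n x + v * ?F n y) \<longlonglongrightarrow> u * F x + v * F y"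
      by (intro tendsto_intros lim)
    ultimately have "u * F x + v * F y \<le> F t + 0"
      by (intro LIMSEQ_le) auto
    then show "F (u *\<^sub>R x + v *\<^sub>R y) \<ge> u * F x + v * F y"
      by (simp add: t_def)
  qed simp
  show "F \<in> asymptotics_class"
    unfolding asymptotics_class_def using \<open>mono F\<close> cont conc range null lip[of 0] by auto
qed

end

section \<open>Sets of small positive measure\<close>

context measure_preserving_map
begin

text \<open>The iterated preimages of an atom \<open>a\<close> all have the same measure, so two of them meet; a common
  point passes through \<open>a\<close> twice, hence \<open>a\<close> is periodic.\<close>

lemma aperiodic_no_point_mass:
  assumes "aperiodic M T" "{a} \<in> sets M"
  shows "prob {a} = 0"
proof (rule ccontr)
  assume "prob {a} \<noteq> 0"
  then have pos: "prob {a} > 0" by (simp add: zero_less_measure_iff)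
  obtain n :: nat where n: "1 < real n * prob {a}"
    using reals_Archimedean3[OF pos] by blast
  have "\<not> disjoint_family_on (\<lambda>i. preim i {a}) {..<n}"
  proof
    assume "disjoint_family_on (\<lambda>i. preim i {a}) {..<n}"
    then have "prob (\<Union>i<n. preim i {a}) = (\<Sum>i<n. prob (preim i {a}))"
      using assms(2) by (intro finite_measure_finite_Union) auto
    also have "\<dots> = real n * prob {a}"
      using measure_preim[OF assms(2)] by simp
    finally show False using n prob_le_1[of "\<Union>i<n. preim i {a}"] by simp
  qed
  then obtain i j x where "i \<noteq> j" "x \<in> preim i {a}" "x \<in> preim j {a}"
    by (auto simp: disjoint_family_on_def)
  then obtain i j where ij: "i < j" "(T ^^ i) x = a" "(T ^^ j) x = a"
    by (auto simp: preim_def) (metis nat_neq_iff)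
  then have "(T ^^ (j - i)) a = a"
    using iterate_add[of i "j - i" x] by simp
  moreover have "AE x in M. (T ^^ (j - i)) x \<noteq> x"
    using assms(1) ij by (simp add: aperiodic_def)
  then obtain N where N: "{x \<in> space M. \<not> (T ^^ (j - i)) x \<noteq> x} \<subseteq> N" "emeasure M N = 0" "N \<in> sets M"
    by (rule AE_E)
  moreover have "a \<in> space M"
    using sets.sets_into_space[OF assms(2)] by simp
  ultimately have "{a} \<subseteq> N" by auto
  then have "prob {a} \<le> prob N"
    using N by (intro finite_measure_mono)
  then show False using pos N by (simp add: measure_def)
qed

text \<open>Suppose that every set of positive measure has measure at least \<open>\<epsilon>\<close>. Cut the space successively
  by the members of a separating family, and keep a piece of positive measure each time. The
  intersection of the pieces still has measure at least \<open>\<epsilon>\<close>, and it is a single point because no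
  member of the family splits it. This contradicts the absence of point masses.\<close>

lemma small_sets:
  assumes "aperiodic M T" "countably_separated M" "\<epsilon> > 0"
  shows "\<exists>A\<in>sets M. 0 < prob A \<and> prob A < \<epsilon>"
proof (rule ccontr)
  assume "\<not> ?thesis"
  then have large: "prob A \<ge> \<epsilon>" if "A \<in> sets M" "0 < prob A" for A
    using that by (meson not_le)
  obtain C N where C: "countable C" "C \<subseteq> sets M" "N \<in> null_sets M"
    and sep: "\<forall>x\<in>space M - N. \<forall>y\<in>space M - N. x \<noteq> y \<longrightarrow> (\<exists>A\<in>C. (x \<in> A) \<noteq> (y \<in> A))"
    using assms(2) unfolding countably_separated_def by blast
  \<comment> \<open>Adding the whole space makes the family nonempty, so that it can be enumerated.\<close>
  define D where "D = from_nat_into (insert (space M) C)"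
  have ran: "range D = insert (space M) C"
    unfolding D_def using C by (intro range_from_nat_into) auto
  then have D: "D n \<in> sets M" for n
    using C ran rangeI[of D n] by auto
  define A where "A = rec_nat (space M - N)
    (\<lambda>n S. if prob (S \<inter> D n) > 0 then S \<inter> D n else S - D n)"
  have A_0: "A 0 = space M - N"
    and A_Suc: "A (Suc n) = (if prob (A n \<inter> D n) > 0 then A n \<inter> D n else A n - D n)" for n
    by (simp_all add: A_def)
  have A: "A n \<in> sets M \<and> prob (A n) > 0" for n
  proof (induction n)
    case 0
    have "prob N = 0" using C by (simp add: measure_def null_setsD1)
    then show ?case using C by (auto simp: A_0 prob_compl)
  next
    case (Suc n)
    have "prob (A n) = prob (A n \<inter> D n) + prob (A n - D n)"
      using Suc D finite_measure_Diff'[of "A n" "D n"] by simp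
    then show ?case using Suc D by (auto simp: A_Suc zero_less_measure_iff)
  qed
  have "A (Suc n) \<subseteq> A n" for n by (auto simp: A_Suc)
  then have dec: "decseq A" by (rule decseq_SucI)
  define P where "P = (\<Inter>n. A n)"
  have P: "P \<in> sets M" unfolding P_def by (rule sets.countable_INT) (use A in auto)
  have "(\<lambda>n. prob (A n)) \<longlonglongrightarrow> prob P"
    unfolding P_def using A dec by (intro finite_Lim_measure_decseq) auto
  then have "prob P \<ge> \<epsilon>"
    using A large by (intro LIMSEQ_le_const) auto
  then have pos: "prob P > 0" using \<open>\<epsilon> > 0\<close> by simp
  then obtain a where a: "a \<in> P" by (metis all_not_in_conv less_irrefl measure_empty)
  have "y = a" if y: "y \<in> P" for y
  proof (rule ccontr)
    assume "y \<noteq> a"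
    moreover have "y \<in> A 0" "a \<in> A 0" using y a by (auto simp: P_def)
    ultimately obtain S where S: "S \<in> C" "(y \<in> S) \<noteq> (a \<in> S)"
      using sep unfolding A_0 by blast
    then obtain n where "S = D n" using ran by blast
    then have n: "(y \<in> D n) \<noteq> (a \<in> D n)" using S by simp
    have "y \<in> A (Suc n)" "a \<in> A (Suc n)" using y a by (auto simp: P_def)
    then show False using n by (auto simp: A_Suc split: if_splits)
  qed
  then have "P = {a}" using a by blast
  then show False using aperiodic_no_point_mass[OF assms(1), of a] P pos by simp
qed

end

section \<open>Rokhlin towers without invertibility\<close>

context measure_preserving_map
begin

text \<open>The sets \<open>B, T\<^sup>-\<^sup>1 B, \<dots>\<close> up to exponent \<open>N - 1\<close> are pairwise disjoint, expressed on forward orbits: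
  a point of \<open>B\<close> does not return to \<open>B\<close> before time \<open>N\<close>.\<close>

definition tower_base :: "nat \<Rightarrow> 'a set \<Rightarrow> bool" where
  "tower_base N B \<longleftrightarrow> B \<in> sets M \<and> (\<forall>x\<in>B. \<forall>d. 0 < d \<and> d < N \<longrightarrow> (T ^^ d) x \<notin> B)"

lemma tower_base_levels:
  assumes "tower_base N B" "(T ^^ i) x \<in> B" "(T ^^ j) x \<in> B" "i < j + N" "j < i + N"
  shows "i = j"
proof -
  have *: False if "(T ^^ i) x \<in> B" "(T ^^ j) x \<in> B" "i < j" "j < i + N" for i j
    using that assms(1) iterate_add[of i "j - i" x] by (auto simp: tower_base_def)
  show ?thesis using *[of i j] *[of j i] assms by (cases i j rule: linorder_cases) auto
qed

lemma prob_tower_union: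
  assumes "tower_base N B" "E \<subseteq> {..<N}"
  shows "prob (\<Union>i\<in>E. preim i B) = real (card E) * prob B"
proof -
  have [simp]: "B \<in> sets M" using assms by (simp add: tower_base_def)
  have "finite E" using assms finite_subset by blast
  have "disjoint_family_on (\<lambda>i. preim i B) E"
    using tower_base_levels[OF assms(1)] assms(2)
    by (fastforce simp: disjoint_family_on_def preim_def)
  then have "prob (\<Union>i\<in>E. preim i B) = (\<Sum>i\<in>E. prob (preim i B))"
    using \<open>finite E\<close> by (intro finite_measure_finite_Union) auto
  then show ?thesis by (simp add: measure_preim)
qed

end

locale ergodic_map = measure_preserving_map +
  assumes ergodic: "A \<in> sets M \<Longrightarrow> T -` A \<inter> space M = A \<Longrightarrow> prob A = 0 \<or> prob A = 1"
begin

text \<open>The preimage of the set of points that visit \<open>A\<close> may be a proper subset of it. The set of points that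
  visit infinitely often is strictly invariant, and it has the same measure because the sets of
  points that visit at time \<open>n\<close> or later decrease and have equal measures.\<close>

lemma ergodic_visits:
  assumes A: "A \<in> sets M" "prob A > 0"
  shows "prob (\<Union>k. preim k A) = 1"
proof -
  define V where "V n = (\<Union>k\<in>{n..}. preim k A)" for n
  have V: "V n \<in> sets M" for n
    unfolding V_def using A by auto
  have shift: "preim 1 (V n) = V (Suc n)" for n
  proof -
    have "{Suc n..} = Suc ` {n..}"
      by (auto simp: image_iff Bex_def dest: Suc_le_D)
    then show ?thesis
      using measurable_space[OF map_measurable]
      by (auto simp: V_def preim_def funpow_swap1)
  qed
  have const: "prob (V n) = prob (V 0)" for n
    by (induction n) (simp_all add: measure_preim[OF V] flip: shift)
  have dec: "decseq V"
    unfolding V_def by (intro decseq_SucI UN_mono) auto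
  define W where "W = (\<Inter>n. V n)"
  have "(\<lambda>n. prob (V n)) \<longlonglongrightarrow> prob W"
    unfolding W_def using V dec by (intro finite_Lim_measure_decseq) auto
  moreover have "(\<lambda>n. prob (V n)) = (\<lambda>n. prob (V 0))"
    using const by blast
  ultimately have W: "prob W = prob (V 0)"
    by (simp only: LIMSEQ_const_iff)
  have "prob (preim 0 A) \<le> prob (V 0)"
    by (intro finite_measure_mono V) (auto simp: V_def)
  then have "prob W > 0"
    using A W measure_preim[of A 0] by simp
  moreover have "T -` W \<inter> space M = W"
  proof -
    have "T -` W \<inter> space M = (\<Inter>n. preim 1 (V n))"
      by (auto simp: W_def preim_def)
    also have "\<dots> = (\<Inter>n. V (Suc n))"
      by (simp only: shift)
    also have "\<dots> = W"
      using decseq_SucD[OF dec] by (auto simp: W_def)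
    finally show ?thesis .
  qed
  moreover have "W \<in> sets M"
    unfolding W_def by (rule sets.countable_INT) (use V in auto)
  ultimately have "prob W = 1"
    using ergodic[of W] by simp
  then show ?thesis using W by (simp add: V_def)
qed

text \<open>The base consists of the points whose first visit to \<open>A\<close> occurs at a positive multiple of \<open>N\<close>. Along
  an orbit the time to the first visit drops by one at each step, so it meets the multiples of \<open>N\<close>
  once in every \<open>N\<close> steps. Points that visit \<open>A\<close> before time \<open>N\<close> may miss the tower; they account
  for the loss \<open>N * prob A\<close>.\<close>

lemma tower_base_from_hitting:
  assumes A: "A \<in> sets M" "prob A > 0" and "N > 0"
  obtains B where "tower_base N B" "real N * prob B \<ge> 1 - real N * prob A"
proof
  define first where "first n = preim n A - (\<Union>k<n. preim k A)" for n
  define B where "B = (\<Union>m\<in>{1..}. first (m * N))"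
  have first: "first n \<in> sets M" for n
    unfolding first_def using A by auto
  have B: "B \<in> sets M"
    unfolding B_def using first by auto
  have first_unique: "m = n" if "x \<in> first m" "x \<in> first n" for m n x
    using that by (cases m n rule: linorder_cases) (auto simp: first_def)
  have first_shift: "(T ^^ d) x \<in> first n" if "x \<in> first (n + d)" for x d n
  proof -
    have *: "(T ^^ k) ((T ^^ d) x) = (T ^^ (k + d)) x" for k
      by (simp add: funpow_add)
    show ?thesis
      using that by (auto simp: first_def preim_def * iterate_in_space)
  qed
  have "(T ^^ d) x \<notin> B" if x: "x \<in> B" and d: "0 < d" "d < N" for x d
  proof
    assume "(T ^^ d) x \<in> B"
    then obtain m' where m': "(T ^^ d) x \<in> first (m' * N)" by (auto simp: B_def)
    obtain m where m: "m \<ge> 1" "x \<in> first (m * N)" using x by (auto simp: B_def)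
    have "d < m * N" using m d
      by (metis One_nat_def Suc_le_eq less_le_trans mult.commute nat_mult_le_cancel_disj mult_1_right)
    then have "(T ^^ d) x \<in> first (m * N - d)"
      using m first_shift[of x "m * N - d" d] by simp
    then have "m * N - d = m' * N"
      using m' first_unique by blast
    then have "d = m * N - m' * N" using \<open>d < m * N\<close> by linarith
    then have "N dvd d" by (simp flip: diff_mult_distrib)
    then show False using d by (simp add: nat_dvd_not_less)
  qed
  then show "tower_base N B"
    using B by (simp add: tower_base_def)
  have cover: "(\<Union>k. preim k A) \<subseteq> (\<Union>k<N. preim k A) \<union> (\<Union>i<N. preim i B)"
  proof
    fix x assume "x \<in> (\<Union>k. preim k A)"
    then have "\<exists>k. x \<in> preim k A" by blast
    define n where "n = (LEAST k. x \<in> preim k A)"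
    have n: "x \<in> first n"
      unfolding first_def n_def using LeastI_ex[OF \<open>\<exists>k. _\<close>] not_less_Least by fastforce
    show "x \<in> (\<Union>k<N. preim k A) \<union> (\<Union>i<N. preim i B)"
    proof (cases "n < N")
      case True
      then show ?thesis using n by (auto simp: first_def)
    next
      case False
      have "n div N * N + n mod N = n" by simp
      then have "(T ^^ (n mod N)) x \<in> first (n div N * N)"
        using n first_shift by metis
      moreover have "n div N \<ge> 1" using False \<open>N > 0\<close> by (simp add: Suc_le_eq div_greater_zero_iff)
      ultimately have "(T ^^ (n mod N)) x \<in> B" by (auto simp: B_def)
      moreover have "x \<in> space M" using n by (simp add: first_def preim_def)
      ultimately have "x \<in> preim (n mod N) B" by (simp add: preim_def)
      then show ?thesis using \<open>N > 0\<close> by auto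
    qed
  qed
  have union: "prob (\<Union>k<N. preim k S) \<le> real N * prob S" if "S \<in> sets M" for S
  proof -
    have "prob (\<Union>k<N. preim k S) \<le> (\<Sum>k<N. prob (preim k S))"
      using that by (intro finite_measure_subadditive_finite) auto
    then show ?thesis using that by (simp add: measure_preim)
  qed
  have "1 \<le> prob ((\<Union>k<N. preim k A) \<union> (\<Union>i<N. preim i B))"
    using finite_measure_mono[OF cover] ergodic_visits[OF A] A B by auto
  also have "\<dots> \<le> prob (\<Union>k<N. preim k A) + prob (\<Union>i<N. preim i B)"
    using A B by (intro measure_Un_le) auto
  also have "\<dots> \<le> real N * prob A + real N * prob B"
    by (intro add_mono union A B)
  finally show "real N * prob B \<ge> 1 - real N * prob A" by simp
qed

lemma Rokhlin_tower:
  assumes "aperiodic M T" "countably_separated M" "\<epsilon> > 0" "N > 0"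
  obtains B where "tower_base N B" "1 - \<epsilon> \<le> real N * prob B" "real N * prob B \<le> 1"
proof -
  obtain A where A: "A \<in> sets M" "0 < prob A" "prob A < \<epsilon> / real N"
    using small_sets[OF assms(1,2), of "\<epsilon> / real N"] assms by auto
  obtain B where B: "tower_base N B" "real N * prob B \<ge> 1 - real N * prob A"
    using tower_base_from_hitting[OF A(1,2) \<open>N > 0\<close>] by metis
  have "real N * prob A \<le> \<epsilon>"
    using A \<open>N > 0\<close> by (simp add: field_simps)
  moreover have "real N * prob B \<le> 1"
    using prob_tower_union[OF B(1), of "{..<N}"] prob_le_1[of "\<Union>i<N. preim i B"] by simp
  ultimately show thesis using B that by simp
qed

end

section \<open>Return times of unions of tower levels\<close>

context measure_preserving_map
begin

text \<open>Points of the level \<open>e k\<close> move down the tower, so the successive differences of \<open>e\<close> are return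
  times of this union to itself.\<close>

definition tower_pattern :: "'a set \<Rightarrow> (nat \<Rightarrow> nat) \<Rightarrow> nat \<Rightarrow> 'a set" where
  "tower_pattern B e K = (\<Union>k\<le>K. preim (e k) B)"

lemma tower_pattern_sets: "tower_base N B \<Longrightarrow> tower_pattern B e K \<in> sets M"
  unfolding tower_pattern_def tower_base_def by auto

lemma prob_tower_pattern:
  assumes "tower_base N B" "strict_mono_on {..K} e" "e K < N"
  shows "prob (tower_pattern B e K) = real (Suc K) * prob B"
proof -
  have "e k \<le> e K" if "k \<le> K" for k
    using strict_mono_on_leD[OF assms(2)] that by simp
  then have "e ` {..K} \<subseteq> {..<N}" using assms(3) by fastforce
  moreover have "card (e ` {..K}) = Suc K"
    using strict_mono_on_imp_inj_on[OF assms(2)] by (simp add: card_image)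
  ultimately show ?thesis
    using prob_tower_union[OF assms(1), of "e ` {..K}"] by (simp add: tower_pattern_def)
qed

text \<open>A point of the level \<open>e (k + 1)\<close> returns exactly after \<open>e (k + 1) - e k\<close> steps, when it reaches the
  level \<open>e k\<close>. Only the bottom level \<open>e 0\<close> is out of control, since its points leave the tower at
  an unknown place; it contributes the uncertainty of one \<open>prob B\<close>.\<close>

lemma return_tail_tower_pattern:
  assumes base: "tower_base N B" and e: "strict_mono_on {..K} e" "e 0 = 0" "e K < N"
  shows "real (card {k. k < K \<and> r < e (Suc k) - e k}) * prob B \<le> return_tail (tower_pattern B e K) r"
      (is "real (card ?G) * _ \<le> return_tail ?U r")
    and "return_tail (tower_pattern B e K) r
           \<le> (real (card {k. k < K \<and> r < e (Suc k) - e k}) + 1) * prob B"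
proof -
  have less: "e i < e j" if "i < j" "j \<le> K" for i j
    using strict_mono_onD[OF e(1)] that by simp
  have le: "e i \<le> e j" if "i \<le> j" "j \<le> K" for i j
    using less[of i j] that by (cases "i = j") auto
  \<comment> \<open>The levels whose points return after more than \<open>r\<close> steps; level 0 may or may not be added.\<close>
  define E where "E = (\<lambda>k. e (Suc k)) ` ?G"
  have "i < N" if "i \<in> insert 0 E" for i
    using that e(3) le[of _ K] by (auto simp: E_def intro: le_less_trans[OF le[of _ K] e(3)])
  then have sub: "E \<subseteq> {..<N}" "insert 0 E \<subseteq> {..<N}" by auto
  have "inj_on (\<lambda>k. e (Suc k)) ?G"
  proof (rule linorder_inj_onI)
    fix i j assume "i < j" "i \<in> ?G" "j \<in> ?G"
    then show "e (Suc i) \<noteq> e (Suc j)" using less[of "Suc i" "Suc j"] by auto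
  qed (simp add: nat_le_linear)
  then have card: "card E = card ?G"
    unfolding E_def by (rule card_image)
  have "finite E" unfolding E_def by simp
  then have card_insert: "card (insert 0 E) \<le> card ?G + 1"
    using card by (simp add: card_insert_if)
  have U: "?U \<in> sets M" using base by (rule tower_pattern_sets)
  have preim: "preim i B \<in> sets M" for i
    using base by (simp add: tower_base_def)
  have lower: "(\<Union>i\<in>E. preim i B) \<subseteq> ?U \<inter> late ?U r"
  proof
    fix x assume "x \<in> (\<Union>i\<in>E. preim i B)"
    then obtain k where k: "k < K" "r < e (Suc k) - e k" and x: "x \<in> preim (e (Suc k)) B"
      by (auto simp: E_def)
    have "x \<in> late ?U r"
    proof (rule ccontr)
      assume "x \<notin> late ?U r"
      then obtain j where j: "1 \<le> j" "j \<le> r" "(T ^^ j) x \<in> ?U"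
        using x by (auto simp: late_def preim_def)
      then obtain i where i: "i \<le> K" "(T ^^ (j + e i)) x \<in> B"
        by (auto simp: tower_pattern_def preim_def iterate_add)
      have "j + e i = e (Suc k)"
      proof (rule tower_base_levels[OF base i(2)])
        show "(T ^^ e (Suc k)) x \<in> B" using x by (simp add: preim_def)
        show "j + e i < e (Suc k) + N" using i j k e(3) le[of i K] by linarith
        show "e (Suc k) < j + e i + N" using k e(3) le[of "Suc k" K] by linarith
      qed
      then have "e k < e i" "e i < e (Suc k)" using j k by auto
      then have "k < i" "i < Suc k"
        using le[of i k] le[of "Suc k" i] i k by (auto simp: not_less[symmetric])
      then show False by simp
    qed
    moreover have "x \<in> ?U" using x k by (auto simp: tower_pattern_def)
    ultimately show "x \<in> ?U \<inter> late ?U r" by simp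
  qed
  have upper: "?U \<inter> late ?U r \<subseteq> (\<Union>i\<in>insert 0 E. preim i B)"
  proof
    fix x assume x: "x \<in> ?U \<inter> late ?U r"
    then obtain i where i: "i \<le> K" "x \<in> preim (e i) B" by (auto simp: tower_pattern_def)
    show "x \<in> (\<Union>i\<in>insert 0 E. preim i B)"
    proof (cases i)
      case 0
      then show ?thesis using i e(2) by simp
    next
      case (Suc k)
      have "r < e (Suc k) - e k"
      proof (rule ccontr)
        assume r: "\<not> r < e (Suc k) - e k"
        define j where "j = e (Suc k) - e k"
        have j: "1 \<le> j" "j \<le> r" "j + e k = e (Suc k)"
          using r less[of k "Suc k"] i Suc by (auto simp: j_def)
        have "(T ^^ e k) ((T ^^ j) x) \<in> B"
          using i Suc iterate_add[of j "e k" x] j by (simp add: preim_def)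
        then have "(T ^^ j) x \<in> ?U"
          using i Suc iterate_in_space[of x j] by (auto simp: tower_pattern_def preim_def)
        then show False using x j by (auto simp: late_def)
      qed
      then have "e i \<in> E" using i Suc by (auto simp: E_def)
      then show ?thesis using i by auto
    qed
  qed
  have "real (card ?G) * prob B = prob (\<Union>i\<in>E. preim i B)"
    using prob_tower_union[OF base sub(1)] card by simp
  also have "\<dots> \<le> return_tail ?U r"
    unfolding return_tail_def using lower U by (intro finite_measure_mono) auto
  finally show "real (card ?G) * prob B \<le> return_tail ?U r" .
  have "return_tail ?U r \<le> prob (\<Union>i\<in>insert 0 E. preim i B)"
    unfolding return_tail_def using upper preim \<open>finite E\<close>
    by (intro finite_measure_mono sets.finite_UN) auto
  also have "\<dots> = real (card (insert 0 E)) * prob B"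
    by (rule prob_tower_union[OF base sub(2)])
  also have "\<dots> \<le> (real (card ?G) + 1) * prob B"
    using card_insert by (intro mult_right_mono) auto
  finally show "return_tail ?U r \<le> (real (card ?G) + 1) * prob B" .
qed

end

section \<open>Gap lists from concave functions\<close>

text \<open>Conjugation of partitions: a decreasing sequence \<open>c\<close>, cut off at \<open>R\<close>, is the sequence of tail counts
  of another one, as \<open>c r\<close> is the number of indices \<open>k\<close> with \<open>g k > r\<close>.\<close>

lemma conjugate_sequence:
  fixes c :: "nat \<Rightarrow> nat"
  assumes "\<And>i j. i \<le> j \<Longrightarrow> c j \<le> c i"
  obtains g :: "nat \<Rightarrow> nat" where "\<And>k r. r < g k \<longleftrightarrow> r < R \<and> k < c r"
proof
  fix k r :: nat
  let ?P = "\<lambda>n. n = R \<or> c n \<le> k"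
  have P: "?P (LEAST n. ?P n)" by (rule LeastI[of ?P R]) simp
  have "(LEAST n. ?P n) \<le> R" by (rule Least_le) simp
  moreover have "\<not> ?P r" if "r < (LEAST n. ?P n)"
    using not_less_Least[OF that] .
  moreover have "r < (LEAST n. ?P n)" if "r < R" "k < c r"
  proof (rule ccontr)
    assume "\<not> r < (LEAST n. ?P n)"
    then show False using P that assms[of "LEAST n. ?P n" r] by auto
  qed
  ultimately show "r < (LEAST n. ?P n) \<longleftrightarrow> r < R \<and> k < c r" by force
qed

text \<open>Both sums count the cells of the same Young diagram.\<close>

lemma sum_conjugate_sequence:
  fixes c g :: "nat \<Rightarrow> nat"
  assumes "\<And>k r. r < g k \<longleftrightarrow> r < R \<and> k < c r" "\<And>r. c r \<le> K"
  shows "(\<Sum>k<K. g k) = (\<Sum>r<R. c r)"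
proof -
  have "g k = (\<Sum>r<R. of_bool (k < c r))" for k
  proof -
    have "{..<g k} = {..<R} \<inter> {r. k < c r}" using assms(1) by auto
    then have "g k = card ({..<R} \<inter> {r. k < c r})" by (metis card_lessThan)
    then show ?thesis by simp
  qed
  then have "(\<Sum>k<K. g k) = (\<Sum>r<R. \<Sum>k<K. of_bool (k < c r))"
    by (simp only: sum.swap[of _ "{..<R}"])
  also have "\<dots> = (\<Sum>r<R. c r)"
  proof (intro sum.cong refl)
    fix r
    have "{..<K} \<inter> {k. k < c r} = {..<c r}" using assms(2)[of r] by auto
    then show "(\<Sum>k<K. of_bool (k < c r)) = c r" by simp
  qed
  finally show ?thesis .
qed

text \<open>The increments of \<open>F\<close> on the grid of mesh \<open>1 / L\<close>, scaled by \<open>K L\<close> and rounded down. Rounding loses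
  at most 1 per term. The first count is set to \<open>K\<close> since each of the \<open>K\<close> gaps must be positive; this
  replaces an increment between 0 and \<open>K\<close>, and explains the error \<open>K\<close> in the upper bound.\<close>

lemma tail_counts:
  fixes K L :: nat
  assumes F: "F \<in> asymptotics_class" and "L > 0"
  obtains c :: "nat \<Rightarrow> nat" where "\<And>i j. i \<le> j \<Longrightarrow> c j \<le> c i" "c 0 = K"
    "\<And>s. real K * real L * F (real s / real L) - real s \<le> (\<Sum>r<s. real (c r))"
    "\<And>s. (\<Sum>r<s. real (c r)) \<le> real K * real L * F (real s / real L) + real K"
proof
  have mono: "mono F" and F0: "F 0 = 0" and le: "\<And>t. t \<ge> 0 \<Longrightarrow> F t \<le> t"
    and conc: "concave_on {0..} F"
    using F by (auto simp: asymptotics_class_def)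
  define \<Phi> where "\<Phi> s = real K * real L * F (real s / real L)" for s :: nat
  define x where "x r = \<Phi> (Suc r) - \<Phi> r" for r
  define c where "c r = (if r = 0 then K else nat \<lfloor>x r\<rfloor>)" for r
  have sum_x: "(\<Sum>r<s. x r) = \<Phi> s" for s
    unfolding x_def by (subst sum_lessThan_telescope) (simp add: \<Phi>_def F0)
  have x_nonneg: "0 \<le> x r" for r
    unfolding x_def \<Phi>_def using \<open>L > 0\<close>
    by (simp add: mult_left_mono monoD[OF mono] divide_right_mono)
  have "x (Suc r) \<le> x r" for r
  proof -
    have "(1 - 1/2) * F (real r / L) + 1/2 * F (real (r + 2) / L)
        \<le> F ((1 - 1/2) *\<^sub>R (real r / L) + (1/2) *\<^sub>R (real (r + 2) / L))"
      by (rule concave_onD[OF conc]) auto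
    also have "(1 - 1/2) *\<^sub>R (real r / L) + (1/2) *\<^sub>R (real (r + 2) / L) = real (Suc r) / L"
      using \<open>L > 0\<close> by (simp add: field_simps)
    finally have "F (real r / L) + F (real (r + 2) / L) \<le> 2 * F (real (Suc r) / L)" by simp
    then have "real K * real L * (F (real r / L) + F (real (r + 2) / L))
        \<le> real K * real L * (2 * F (real (Suc r) / L))"
      by (intro mult_left_mono) auto
    then show ?thesis by (simp add: x_def \<Phi>_def algebra_simps)
  qed
  then have x_anti: "x j \<le> x i" if "i \<le> j" for i j
    using that by (rule lift_Suc_antimono_le)
  have "x 0 \<le> real K"
  proof -
    have "real K * real L * F (1 / L) \<le> real K * real L * (1 / L)"
      using le[of "1 / L"] by (intro mult_left_mono) auto
    then show ?thesis using \<open>L > 0\<close> by (simp add: x_def \<Phi>_def F0)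
  qed
  then have x_le: "x r \<le> real K" for r using x_anti[of 0 r] by simp
  show "c j \<le> c i" if "i \<le> j" for i j
  proof -
    have "nat \<lfloor>x j\<rfloor> \<le> K" using x_le[of j] by linarith
    moreover have "nat \<lfloor>x j\<rfloor> \<le> nat \<lfloor>x i\<rfloor>" using x_anti[OF that] by (intro nat_mono floor_mono)
    ultimately show ?thesis using that by (auto simp: c_def)
  qed
  show "c 0 = K" by (simp add: c_def)
  have c_lower: "x r - 1 \<le> real (c r)" for r
  proof -
    have "x r - 1 \<le> real (nat \<lfloor>x r\<rfloor>)" using x_nonneg[of r] by linarith
    then show ?thesis using x_le[of r] by (auto simp: c_def)
  qed
  have c_upper: "real (c r) \<le> x r + (if r = 0 then real K else 0)" for r
    using x_nonneg[of r] by (auto simp: c_def)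
  fix s
  have "\<Phi> s - real s = (\<Sum>r<s. x r - 1)" by (simp add: sum_subtractf sum_x)
  also have "\<dots> \<le> (\<Sum>r<s. real (c r))" by (intro sum_mono c_lower)
  finally show "real K * real L * F (real s / real L) - real s \<le> (\<Sum>r<s. real (c r))"
    by (simp add: \<Phi>_def)
  have "(\<Sum>r<s. real (c r)) \<le> (\<Sum>r<s. x r + (if r = 0 then real K else 0))"
    by (intro sum_mono c_upper)
  also have "\<dots> \<le> \<Phi> s + real K" by (simp add: sum.distrib sum_x)
  finally show "(\<Sum>r<s. real (c r)) \<le> real K * real L * F (real s / real L) + real K"
    by (simp add: \<Phi>_def)
qed

context ergodic_map
begin

text \<open>Here \<open>K = L\<^sup>2\<close>, and the gaps are cut off at length \<open>K\<close>, which is time \<open>L\<close> on the scale of \<open>F\<close>; so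
  every fixed time is covered once \<open>L\<close> is large. The errors are of order \<open>\<beta> K\<close>, against a total mass
  of order \<open>\<beta> K L\<close>. The number \<open>\<beta>\<close> is the measure of a tower base, which is close to \<open>1 / N\<close>.\<close>

lemma approximating_set:
  fixes L :: nat
  defines "N \<equiv> L\<^sup>2 * (L + 1) + 1"
  assumes "aperiodic M T" "countably_separated M" and F: "F \<in> asymptotics_class" and "L > 0"
  obtains U \<beta> where "U \<in> sets M" "\<beta> > 0" "1 - 1 / (real L + 1) \<le> real N * \<beta>" "real N * \<beta> \<le> 1"
    "prob U = real (L\<^sup>2 + 1) * \<beta>"
    "\<And>s. s \<le> L\<^sup>2 \<Longrightarrow>
       \<bar>(\<Sum>r<s. return_tail U r) - \<beta> * real (L\<^sup>2) * real L * F (real s / real L)\<bar> \<le> 2 * \<beta> * real (L\<^sup>2)"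
proof -
  define K where "K = L\<^sup>2"
  have N: "N = K * (L + 1) + 1" by (simp add: N_def K_def)
  obtain c where anti: "\<And>i j. i \<le> j \<Longrightarrow> c j \<le> c i" and c0: "c 0 = K"
    and c_lower: "\<And>s. real K * real L * F (real s / real L) - real s \<le> (\<Sum>r<s. real (c r))"
    and c_upper: "\<And>s. (\<Sum>r<s. real (c r)) \<le> real K * real L * F (real s / real L) + real K"
    using tail_counts[OF F \<open>L > 0\<close>, where K = K] by metis
  have c_le: "c r \<le> K" for r using anti[of 0 r] c0 by simp
  obtain g where g: "\<And>k r. r < g k \<longleftrightarrow> r < K \<and> k < c r"
    using conjugate_sequence[of c K] anti by metis
  define e where "e k = (\<Sum>j<k. g j)" for k
  have e_0: "e 0 = 0" by (simp add: e_def)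
  have "K > 0" using \<open>L > 0\<close> by (simp add: K_def)
  have "g k > 0" if "k < K" for k using g[of 0 k] that \<open>K > 0\<close> c0 by simp
  then have e_mono: "strict_mono_on {..K} e"
    unfolding e_def
    by (intro strict_mono_onI sum_strict_mono2) (auto simp: subset_iff)
  have "real (e K) = (\<Sum>r<K. real (c r))"
    unfolding e_def using sum_conjugate_sequence[OF g c_le] by (metis of_nat_sum)
  also have "\<dots> \<le> real K * real L * F (real K / real L) + real K" by (rule c_upper)
  also have "\<dots> \<le> real K * real L * 1 + real K"
    using F by (intro add_mono mult_left_mono) (auto simp: asymptotics_class_def)
  also have "\<dots> = real (N - 1)" by (simp add: N algebra_simps)
  finally have "e K < N" using N by linarith
  obtain B where B: "tower_base N B" "1 - 1 / (real L + 1) \<le> real N * prob B" "real N * prob B \<le> 1"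
    using Rokhlin_tower[of "1 / (real L + 1)" N] assms(2,3) N by auto
  define \<beta> where "\<beta> = prob B"
  define U where "U = tower_pattern B e K"
  have "\<beta> > 0"
  proof (rule ccontr)
    assume "\<not> \<beta> > 0"
    then have "prob B = 0" using measure_nonneg[of M B] by (simp add: \<beta>_def)
    then show False using B(2) \<open>L > 0\<close> by (simp add: field_simps)
  qed
  have tail: "real (c r) * \<beta> \<le> return_tail U r" "return_tail U r \<le> (real (c r) + 1) * \<beta>"
    if "r < K" for r
  proof -
    have "e (Suc k) - e k = g k" for k
      by (simp add: e_def)
    then have "{k. k < K \<and> r < e (Suc k) - e k} = {k. k < K \<and> k < c r}"
      using that by (simp add: g)
    also have "\<dots> = {..<c r}"
      using c_le[of r] by auto
    finally have "card {k. k < K \<and> r < e (Suc k) - e k} = c r" by simp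
    then show "real (c r) * \<beta> \<le> return_tail U r" "return_tail U r \<le> (real (c r) + 1) * \<beta>"
      using return_tail_tower_pattern[OF B(1) e_mono e_0 \<open>e K < N\<close>, of r]
      by (simp_all add: U_def \<beta>_def)
  qed
  show thesis
  proof (rule that[of U \<beta>])
    show "U \<in> sets M" using B(1) by (simp add: U_def tower_pattern_sets)
    show "prob U = real (L\<^sup>2 + 1) * \<beta>"
      using prob_tower_pattern[OF B(1) e_mono \<open>e K < N\<close>] by (simp add: U_def \<beta>_def K_def)
    fix s assume "s \<le> L\<^sup>2"
    then have s: "s \<le> K" by (simp add: K_def)
    define y where "y = real K * real L * F (real s / real L)"
    have "(y - real K) * \<beta> \<le> (\<Sum>r<s. real (c r)) * \<beta>"
      using c_lower[of s] s \<open>\<beta> > 0\<close> by (intro mult_right_mono) (auto simp: y_def)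
    also have "\<dots> \<le> (\<Sum>r<s. return_tail U r)"
      unfolding sum_distrib_right using s by (intro sum_mono tail) auto
    finally have 1: "(y - real K) * \<beta> \<le> (\<Sum>r<s. return_tail U r)" .
    have "(\<Sum>r<s. return_tail U r) \<le> (\<Sum>r<s. (real (c r) + 1) * \<beta>)"
      using s by (intro sum_mono tail) auto
    also have "\<dots> = ((\<Sum>r<s. real (c r)) + real s) * \<beta>"
      by (simp add: sum.distrib flip: sum_distrib_right)
    also have "\<dots> \<le> (y + real K + real K) * \<beta>"
      using c_upper[of s] s \<open>\<beta> > 0\<close> by (intro mult_right_mono) (auto simp: y_def)
    finally have 2: "(\<Sum>r<s. return_tail U r) \<le> (y + real K + real K) * \<beta>" .
    have "0 \<le> real K * \<beta>" using \<open>\<beta> > 0\<close> by simp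
    then have "\<bar>(\<Sum>r<s. return_tail U r) - \<beta> * y\<bar> \<le> 2 * \<beta> * real K"
      using 1 2 by (simp add: algebra_simps abs_le_iff)
    then show "\<bar>(\<Sum>r<s. return_tail U r) - \<beta> * real (L\<^sup>2) * real L * F (real s / real L)\<bar>
        \<le> 2 * \<beta> * real (L\<^sup>2)"
      by (simp add: y_def K_def mult.assoc)
  qed (use \<open>\<beta> > 0\<close> B in \<open>simp_all add: \<beta>_def\<close>)
qed

end

section \<open>Realisation of a prescribed limit\<close>

context ergodic_map
begin

text \<open>The sets of \<open>approximating_set\<close> for \<open>L = n + 1\<close>. Their measure is asymptotic to \<open>1 / L\<close>, so the scaled
  time \<open>t\<close> corresponds to about \<open>t L\<close> steps, that is, to the grid point \<open>q n\<close> near \<open>t\<close>. The continuity of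
  \<open>F\<close> absorbs the difference between \<open>q n\<close> and \<open>t\<close>.\<close>

lemma class_imp_hitting_asymptotic:
  assumes aper: "aperiodic M T" and sep: "countably_separated M" and F: "F \<in> asymptotics_class"
  shows "hitting_asymptotic M T F"
proof -
  define N where "N n = (Suc n)\<^sup>2 * (Suc n + 1) + 1" for n :: nat
  define K where "K n = (Suc n)\<^sup>2" for n :: nat
  have "\<exists>U \<beta>. U \<in> sets M \<and> \<beta> > 0 \<and> 1 - 1 / (real (Suc n) + 1) \<le> real (N n) * \<beta> \<and> real (N n) * \<beta> \<le> 1
    \<and> prob U = real (K n + 1) * \<beta> \<and>
    (\<forall>s\<le>K n. \<bar>(\<Sum>r<s. return_tail U r) - \<beta> * real (K n) * real (Suc n) * F (real s / real (Suc n))\<bar>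
       \<le> 2 * \<beta> * real (K n))" for n
    unfolding N_def K_def
    by (rule approximating_set[OF aper sep F zero_less_Suc, of n]) blast
  then obtain U \<beta> where U: "\<And>n. U n \<in> sets M" and \<beta>: "\<And>n. \<beta> n > 0"
    and a_lower: "\<And>n. 1 - 1 / (real (Suc n) + 1) \<le> real (N n) * \<beta> n"
    and a_upper: "\<And>n. real (N n) * \<beta> n \<le> 1"
    and prob_U: "\<And>n. prob (U n) = real (K n + 1) * \<beta> n"
    and approx: "\<And>n s. s \<le> K n \<Longrightarrow>
      \<bar>(\<Sum>r<s. return_tail (U n) r) - \<beta> n * real (K n) * real (Suc n) * F (real s / real (Suc n))\<bar>
       \<le> 2 * \<beta> n * real (K n)"
    by metis
  have pos: "prob (U n) > 0" for n
    using \<beta>[of n] by (simp add: prob_U)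
  define a where "a n = real (N n) * \<beta> n" for n
  have "(\<lambda>n. 1 - 1 / (real (Suc n) + 1)) \<longlonglongrightarrow> 1"
    by real_asymp
  then have a: "a \<longlonglongrightarrow> 1"
    using a_lower a_upper unfolding a_def[symmetric]
    by (intro tendsto_sandwich[of "\<lambda>n. 1 - 1 / (real (Suc n) + 1)" a sequentially "\<lambda>_. 1"]) auto
  have N_pos: "real (N n) > 0" for n
    unfolding N_def of_nat_0_less_iff by (intro add_nonneg_pos) simp_all
  have \<beta>_a: "\<beta> n = a n / real (N n)" for n
    using N_pos[of n] by (simp add: a_def)
  have N_real: "real (N n) = (real n + 1) ^ 2 * (real n + 2) + 1" for n
    by (simp add: N_def algebra_simps)
  have K_real: "real (K n) = (real n + 1) ^ 2" for n
    by (simp add: K_def algebra_simps)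
  have lim_prob: "(\<lambda>n. prob (U n)) \<longlonglongrightarrow> 0"
  proof -
    have "(\<lambda>n. (real (K n) + 1) / real (N n)) \<longlonglongrightarrow> 0"
      unfolding N_real K_real by real_asymp
    from tendsto_mult[OF a this] show ?thesis by (simp add: prob_U \<beta>_a algebra_simps)
  qed
  have lim_scale: "(\<lambda>n. real (Suc n) * prob (U n)) \<longlonglongrightarrow> 1"
  proof -
    have "(\<lambda>n. (real n + 1) * (real (K n) + 1) / real (N n)) \<longlonglongrightarrow> 1"
      unfolding N_real K_real by real_asymp
    from tendsto_mult[OF a this] show ?thesis by (simp add: prob_U \<beta>_a algebra_simps)
  qed
  have lim_factor: "(\<lambda>n. \<beta> n * real (K n) * real (Suc n)) \<longlonglongrightarrow> 1"
  proof -
    have "(\<lambda>n. real (K n) * (real n + 1) / real (N n)) \<longlonglongrightarrow> 1"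
      unfolding N_real K_real by real_asymp
    from tendsto_mult[OF a this] show ?thesis by (simp add: \<beta>_a algebra_simps)
  qed
  have lim_error: "(\<lambda>n. 2 * \<beta> n * real (K n)) \<longlonglongrightarrow> 0"
  proof -
    have "(\<lambda>n. 2 * real (K n) / real (N n)) \<longlonglongrightarrow> 0"
      unfolding N_real K_real by real_asymp
    from tendsto_mult[OF a this] show ?thesis by (simp add: \<beta>_a algebra_simps)
  qed
  have "(\<lambda>n. hitting_cdf M T (U n) t) \<longlonglongrightarrow> F t" for t
  proof (cases "t \<le> 0")
    case True
    then show ?thesis
      using F pos by (simp add: hitting_cdf_nonpos asymptotics_class_def)
  next
    case False
    define s where "s n = nat \<lfloor>t / prob (U n)\<rfloor>" for n
    define q where "q n = real (s n) / real (Suc n)" for n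
    define r where "r n = t / (real (Suc n) * prob (U n))" for n
    have r: "r \<longlonglongrightarrow> t"
      using tendsto_divide[OF tendsto_const[of t] lim_scale] by (simp add: r_def[abs_def])
    have q_bounds: "r n - 1 / real (Suc n) \<le> q n" "q n \<le> r n" for n
    proof -
      have "0 \<le> t / prob (U n)" using False pos[of n] by simp
      then have "t / prob (U n) - 1 \<le> real (s n)" "real (s n) \<le> t / prob (U n)"
        unfolding s_def by linarith+
      then have "(t / prob (U n) - 1) / real (Suc n) \<le> q n" "q n \<le> (t / prob (U n)) / real (Suc n)"
        unfolding q_def by (intro divide_right_mono; simp)+
      then show "r n - 1 / real (Suc n) \<le> q n" "q n \<le> r n"
        by (simp_all add: r_def diff_divide_distrib mult.commute)
    qed
    have q: "q \<longlonglongrightarrow> t"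
    proof (rule tendsto_sandwich)
      have "(\<lambda>n. 1 / real (Suc n)) \<longlonglongrightarrow> 0" by real_asymp
      from tendsto_diff[OF r this] show "(\<lambda>n. r n - 1 / real (Suc n)) \<longlonglongrightarrow> t" by simp
    qed (use r q_bounds in auto)
    have "isCont F t"
      using F by (simp add: asymptotics_class_def continuous_on_eq_continuous_at)
    then have F_q: "(\<lambda>n. F (q n)) \<longlonglongrightarrow> F t"
      using q by (rule isCont_tendsto_compose)
    \<comment> \<open>The estimate of \<open>approximating_set\<close> needs \<open>s n \<le> (n + 1)\<^sup>2\<close>, that is \<open>q n \<le> n + 1\<close>.\<close>
    have "\<forall>\<^sub>F n in sequentially. q n < t + 1"
      using q by (rule order_tendstoD) simp
    moreover have "\<forall>\<^sub>F n in sequentially. t + 1 < real (Suc n)"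
      by real_asymp
    ultimately have ev: "\<forall>\<^sub>F n in sequentially.
      \<bar>hitting_cdf M T (U n) t - \<beta> n * real (K n) * real (Suc n) * F (q n)\<bar> \<le> 2 * \<beta> n * real (K n)"
    proof eventually_elim
      case (elim n)
      then have "real (s n) / real (Suc n) < real (Suc n)"
        unfolding q_def by (rule less_trans)
      then have "real (s n) < real (Suc n) * real (Suc n)"
        by (subst (asm) pos_divide_less_eq) simp_all
      then have "s n < Suc n * Suc n"
        by (simp only: of_nat_less_iff flip: of_nat_mult)
      then have "s n \<le> K n"
        by (simp add: K_def power2_eq_square)
      then show ?case
        using approx[of "s n" n] False pos U by (simp add: hitting_cdf_eq_sum s_def q_def)
    qed
    have "(\<lambda>n. hitting_cdf M T (U n) t - \<beta> n * real (K n) * real (Suc n) * F (q n)) \<longlonglongrightarrow> 0"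
      using ev by (intro Lim_null_comparison[OF _ lim_error]) (simp only: real_norm_def)
    from tendsto_add[OF this tendsto_mult[OF lim_factor F_q]] show ?thesis by simp
  qed
  moreover have "mono F" using F by (simp add: asymptotics_class_def)
  ultimately show ?thesis
    unfolding hitting_asymptotic_def weakly_converges_def weak_conv_def
    using U pos lim_prob by (intro exI[of _ U]) simp
qed

end

theorem theorem1:
  fixes M :: "'a measure" and T :: "'a \<Rightarrow> 'a"
  assumes "ergodic_system M T"
    and "aperiodic M T"
    and "countably_separated M"
  shows "(\<forall>F. mono F \<longrightarrow> (hitting_asymptotic M T F \<longleftrightarrow> F \<in> asymptotics_class)) \<and>
         {F. hitting_asymptotic M T F} = asymptotics_class"
proof -
  interpret prob_space M
    using assms(1) by (simp add: ergodic_system_def)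
  interpret ergodic_map M T
    by unfold_locales (use assms(1) in \<open>auto simp: ergodic_system_def\<close>)
  have "hitting_asymptotic M T F \<longleftrightarrow> F \<in> asymptotics_class" for F
    using hitting_asymptotic_imp_class class_imp_hitting_asymptotic[OF assms(2,3)] by blast
  then show ?thesis by blast
qed

end
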